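(* Let $G=\frac{1+\sqrt5}{2}$, let $q_2\approx1.71064$ be the root in $(G,2)$ of $x^4=2x^2+x+1$, and let $q_f\approx1.75488$ be the real root of $x^3=2x^2-x+1$. For any $q\in(G,q_2)\cup(q_2,q_f)$, each $x\in[0,1/(q-1)]$ has either a unique expansion or infinitely many expansions in base $q$.
   Context: An expansion of $x\ge0$ in base $q\in(1,2)$ is a 0-1 sequence $(a_n)_{n\ge1}$ with $x=\sum_{n\ge1}a_nq^{-n}$. *)

theory Defs
  imports "HOL-Analysis.Analysis"
begin

(* Digit sequences are indexed from 0, so the term a n here is the digit a_{n+1}
   of the usual indexing and has weight q^(-(n+1)). *)
definition expansion :: "real \<Rightarrow> real \<Rightarrow> (nat \<Rightarrow> nat) \<Rightarrow> bool" where
  "expansion q x a \<longleftrightarrow>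
     (\<forall>n. a n \<in> {0, 1}) \<and> (\<lambda>n. real (a n) / q ^ Suc n) sums x"

definition golden :: real where
  "golden = (1 + sqrt 5) / 2"

definition q_two :: real where
  "q_two = (THE x. golden < x \<and> x < 2 \<and> x ^ 4 = 2 * x ^ 2 + x + 1)"

definition q_f :: real where
  "q_f = (THE x. x ^ 3 = 2 * x ^ 2 - x + 1)"

lemma golden_bounds: "1.61 < golden" "golden < 1.62"
proof -
  have "2.22 < sqrt 5" by (rule real_less_rsqrt) (simp add: power2_eq_square)
  moreover have "sqrt 5 < 2.24" by (rule real_less_lsqrt) (simp_all add: power2_eq_square)
  ultimately show "1.61 < golden" "golden < 1.62" by (simp_all add: golden_def)
qed

lemma ex1_q_two: "\<exists>!x. golden < x \<and> x < 2 \<and> x ^ 4 = 2 * x ^ 2 + x + 1"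
  and q_two_approx: "1.71063 < q_two" "q_two < 1.71065"
proof -
  define p :: "real \<Rightarrow> real" where "p = (\<lambda>x. x ^ 4 - 2 * x ^ 2 - x - 1)"
  have "\<exists>x\<ge>1.71063. x \<le> 1.71065 \<and> p x = 0"
    by (rule IVT) (auto simp: p_def power_numeral_reduce)
  then obtain r where r: "1.71063 \<le> r" "r \<le> 1.71065" "p r = 0" by blast
  have "p 1.71063 \<noteq> 0" "p 1.71065 \<noteq> 0" by (simp_all add: p_def power_numeral_reduce)
  with r have bounds: "1.71063 < r" "r < 1.71065"
    by (metis less_eq_real_def)+
  have uniq: "x = y" if "golden < x" "golden < y" "p x = 0" "p y = 0" for x y
  proof -
    have gt: "x > 1.61" "y > 1.61" using that golden_bounds by auto
    have "x * x > 1.61 * 1.61" "y * y > 1.61 * 1.61"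
      using gt by (intro mult_strict_mono; simp)+
    then have "x * x + y * y - 2 > 1" by simp
    then have "(x + y) * (x * x + y * y - 2) > 1 * 1"
      using gt by (intro mult_strict_mono) auto
    moreover have "p x - p y = (x - y) * ((x + y) * (x * x + y * y - 2) - 1)"
      by (simp add: p_def algebra_simps power_numeral_reduce)
    ultimately show "x = y" using that by auto
  qed
  have root: "golden < r \<and> r < 2 \<and> r ^ 4 = 2 * r ^ 2 + r + 1"
    using r golden_bounds by (auto simp: p_def)
  have only: "x = r" if "golden < x \<and> x < 2 \<and> x ^ 4 = 2 * x ^ 2 + x + 1" for x
  proof (rule uniq)
    show "golden < x" "p x = 0" using that by (simp_all add: p_def)
    show "golden < r" "p r = 0" using root r(3) by blast+
  qed
  show "\<exists>!x. golden < x \<and> x < 2 \<and> x ^ 4 = 2 * x ^ 2 + x + 1"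
    using root only by blast
  have "q_two = r"
    unfolding q_two_def using root only by (rule the_equality)
  with bounds show "1.71063 < q_two" "q_two < 1.71065" by simp_all
qed

lemma ex1_q_f: "\<exists>!x::real. x ^ 3 = 2 * x ^ 2 - x + 1"
  and q_f_approx: "1.75487 < q_f" "q_f < 1.75489"
proof -
  define p :: "real \<Rightarrow> real" where "p = (\<lambda>x. x ^ 3 - 2 * x ^ 2 + x - 1)"
  have "\<exists>x\<ge>1.75487. x \<le> 1.75489 \<and> p x = 0"
    by (rule IVT) (auto simp: p_def power_numeral_reduce)
  then obtain r where r: "1.75487 \<le> r" "r \<le> 1.75489" "p r = 0" by blast
  have "p 1.75487 \<noteq> 0" "p 1.75489 \<noteq> 0" by (simp_all add: p_def power_numeral_reduce)
  with r have bounds: "1.75487 < r" "r < 1.75489"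
    by (metis less_eq_real_def)+
  have gt1: "x > 1" if "p x = 0" for x
  proof (rule ccontr)
    assume "\<not> x > 1"
    then have le: "x \<le> 1" by simp
    have eq: "x * (x - 1)\<^sup>2 = 1"
      using that by (simp add: p_def algebra_simps power_numeral_reduce)
    then have pos: "x > 0"
      using mult_nonpos_nonneg[of x "(x - 1)\<^sup>2"] by (cases "x > 0") auto
    have "(x - 1)\<^sup>2 < 1"
      using pos le by (simp add: abs_square_less_1)
    moreover have "x * (x - 1)\<^sup>2 \<le> 1 * (x - 1)\<^sup>2"
      using le by (intro mult_right_mono) auto
    ultimately show False using eq by simp
  qed
  have uniq: "x = y" if "p x = 0" "p y = 0" for x y
  proof -
    define u v where "u = x - 1" and "v = y - 1"
    have uv: "u > 0" "v > 0" using gt1 that by (auto simp: u_def v_def)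
    have "p x - p y = (u - v) * (u * u + u * v + v * v + u + v)"
      by (simp add: p_def u_def v_def algebra_simps power_numeral_reduce)
    moreover have "u * u + u * v + v * v + u + v > 0"
      using uv by (intro add_pos_pos mult_pos_pos)
    ultimately have "u = v" using that by auto
    then show "x = y" by (simp add: u_def v_def)
  qed
  have root: "r ^ 3 = 2 * r ^ 2 - r + 1" using r by (simp add: p_def)
  have only: "x = r" if "x ^ 3 = 2 * x ^ 2 - x + 1" for x
  proof (rule uniq)
    show "p x = 0" using that by (simp add: p_def)
    show "p r = 0" by (rule r(3))
  qed
  show "\<exists>!x::real. x ^ 3 = 2 * x ^ 2 - x + 1" using root only by blast
  have "q_f = r"
    unfolding q_f_def using root only by (rule the_equality)
  with bounds show "1.75487 < q_f" "q_f < 1.75489" by simp_all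
qed

end

theory Submission
  imports Defs
begin

text \<open>
  If some point has a finite number of expansions, at least two, then following the branching
  down to a last branching point produces \<open>z\<close> such that \<open>z\<close> and \<open>z + 1\<close> both have a unique
  expansion. The orbit of a point with a unique expansion avoids the switch region
  \<open>[1/q, 1/(q(q-1))]\<close>. For \<open>q < q_f\<close> this forces every such orbit, unless it ends in one of the
  fixed points \<open>0\<close> and \<open>1/(q-1)\<close>, to run into \<open>(1/(q(q-1)), 1)\<close> and to stay in that interval under
  the expanding map \<open>y \<mapsto> q\<^sup>2 y - q\<close>, hence to hit its fixed point \<open>q/(q\<^sup>2-1)\<close>. So the points with a
  unique expansion are \<open>0\<close>, the points \<open>q\<^sup>1\<^sup>-\<^sup>n/(q\<^sup>2-1)\<close> and their reflections, and two of these
  differ by \<open>1\<close> only for \<open>q = q_two\<close> if \<open>golden < q < q_f\<close>.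
\<close>

definition expansions :: "real \<Rightarrow> real \<Rightarrow> (nat \<Rightarrow> nat) set" where
  "expansions q x = {a. expansion q x a}"

section \<open>Branching of expansions\<close>

lemma expansion_shift:
  assumes "q > 0"
  shows "expansion q x a \<longleftrightarrow>
    a 0 \<in> {0, 1} \<and> expansion q (q * x - real (a 0)) (\<lambda>n. a (Suc n))"
proof -
  let ?f = "\<lambda>n. real (a n) / q ^ Suc n"
  have "?f sums x \<longleftrightarrow> (\<lambda>n. ?f (Suc n)) sums (x - ?f 0)"
    using sums_Suc_iff[of ?f "x - ?f 0"] by (simp only: diff_add_cancel)
  also have "\<dots> \<longleftrightarrow> (\<lambda>n. q * ?f (Suc n)) sums (q * (x - ?f 0))"
    using assms by (intro sums_mult_iff[symmetric]) auto
  also have "(\<lambda>n. q * ?f (Suc n)) = (\<lambda>n. real (a (Suc n)) / q ^ Suc n)"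
    using assms by (auto simp: fun_eq_iff field_simps)
  also have "q * (x - ?f 0) = q * x - real (a 0)"
    using assms by (simp add: field_simps)
  finally have "?f sums x \<longleftrightarrow> (\<lambda>n. real (a (Suc n)) / q ^ Suc n) sums (q * x - real (a 0))" .
  moreover have "(\<forall>n. a n \<in> {0, 1}) \<longleftrightarrow> a 0 \<in> {0, 1} \<and> (\<forall>n. a (Suc n) \<in> {0, 1})"
    by (metis not0_implies_Suc)
  ultimately show ?thesis
    unfolding expansion_def by blast
qed

text \<open>Each first digit gives one branch; a branch is empty exactly when that digit cannot
  begin an expansion of \<open>x\<close>, so all counting reduces to the points \<open>q * x\<close>
  and \<open>q * x - 1\<close>.\<close>

lemma expansions_branch:
  assumes "q > 0"
  shows "expansions q x =
    case_nat 0 ` expansions q (q * x) \<union> case_nat 1 ` expansions q (q * x - 1)"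
proof (intro set_eqI iffI)
  fix a assume "a \<in> expansions q x"
  then have *: "a 0 \<in> {0, 1}" "expansion q (q * x - real (a 0)) (\<lambda>n. a (Suc n))"
    using expansion_shift[OF assms, of x a] by (simp_all add: expansions_def)
  have "a = case_nat (a 0) (\<lambda>n. a (Suc n))"
    by (auto simp: fun_eq_iff split: nat.split)
  then show "a \<in> case_nat 0 ` expansions q (q * x) \<union> case_nat 1 ` expansions q (q * x - 1)"
    using * by (cases "a 0 = 0") (auto simp: expansions_def)
next
  fix a assume "a \<in> case_nat 0 ` expansions q (q * x) \<union> case_nat 1 ` expansions q (q * x - 1)"
  then show "a \<in> expansions q x"
    using expansion_shift[OF assms, of x a] by (auto simp: expansions_def)
qed

lemma inj_case_nat: "inj_on (case_nat d) A"
proof (rule inj_onI)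
  fix f g :: "nat \<Rightarrow> 'a" assume "case_nat d f = case_nat d g"
  then have "case_nat d f (Suc n) = case_nat d g (Suc n)" for n by simp
  then show "f = g" by auto
qed

lemma finite_expansions_branch:
  assumes "q > 0" "finite (expansions q x)"
  shows "finite (expansions q (q * x))" "finite (expansions q (q * x - 1))"
  using assms finite_imageD[OF _ inj_case_nat] expansions_branch[of q x] by (metis finite_Un)+

lemma card_expansions_branch:
  assumes "q > 0" "finite (expansions q x)"
  shows "card (expansions q x) = card (expansions q (q * x)) + card (expansions q (q * x - 1))"
proof -
  have "case_nat 0 ` expansions q (q * x) \<inter> case_nat 1 ` expansions q (q * x - 1) = {}"
    by (auto simp: fun_eq_iff dest!: spec[of _ 0])
  then show ?thesis
    using finite_expansions_branch[OF assms]
    by (simp add: expansions_branch[OF assms(1), of x] card_Un_disjoint card_image inj_case_nat)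
qed

lemma expansion_tail:
  assumes "q > 0" "a \<in> expansions q x"
  shows "a 0 \<in> {0, 1}" "(\<lambda>n. a (Suc n)) \<in> expansions q (q * x - real (a 0))"
  using assms expansion_shift[of q x a] by (auto simp: expansions_def)

text \<open>Strip the digits on which \<open>a\<close> and \<open>b\<close> agree. Each stripped
  digit moves to one of the two branches, which has at most as many expansions; at the first
  disagreement both branches are inhabited.\<close>

lemma exists_branching_point:
  assumes q: "q > 0" and "finite (expansions q x)"
    and "a \<in> expansions q x" "b \<in> expansions q x" "a n \<noteq> b n"
  shows "\<exists>y. finite (expansions q y) \<and> card (expansions q y) \<le> card (expansions q x) \<and>
    expansions q (q * y) \<noteq> {} \<and> expansions q (q * y - 1) \<noteq> {}"
  using assms(2-)
proof (induction n arbitrary: x a b rule: less_induct)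
  case (less n)
  note fin = finite_expansions_branch[OF q less.prems(1)]
  note tl = expansion_tail[OF q less.prems(2)] expansion_tail[OF q less.prems(3)]
  show ?case
  proof (cases "a 0 = b 0")
    case True
    with less.prems obtain m where m: "n = Suc m" by (cases n) auto
    let ?y = "q * x - real (a 0)"
    have "?y = q * x \<or> ?y = q * x - 1" using tl(1) by auto
    then have y: "finite (expansions q ?y)" "card (expansions q ?y) \<le> card (expansions q x)"
      using fin card_expansions_branch[OF q less.prems(1)] by auto
    have "\<exists>z. finite (expansions q z) \<and> card (expansions q z) \<le> card (expansions q ?y) \<and>
      expansions q (q * z) \<noteq> {} \<and> expansions q (q * z - 1) \<noteq> {}"
    proof (rule less.IH[OF _ y(1) tl(2)])
      show "m < n" using m by simp
      show "(\<lambda>n. b (Suc n)) \<in> expansions q ?y" using tl(4) unfolding True .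
      show "a (Suc m) \<noteq> b (Suc m)" using less.prems(4) unfolding m .
    qed
    then show ?thesis using y(2) le_trans by blast
  next
    case False
    then consider "a 0 = 0" "b 0 = 1" | "a 0 = 1" "b 0 = 0" using tl(1,3) by auto
    then have "expansions q (q * x) \<noteq> {} \<and> expansions q (q * x - 1) \<noteq> {}"
      using tl(2,4) by cases auto
    then show ?thesis using less.prems(1) by blast
  qed
qed

text \<open>Induction on the number of expansions: at a branching point both branches are nonempty,
  so each has strictly fewer expansions than \<open>x\<close>. Either some branch still has two and
  the descent continues, or both have exactly one.\<close>

lemma exists_adjacent_unique:
  assumes q: "q > 0" and "finite (expansions q x)"
    and "a \<in> expansions q x" "b \<in> expansions q x" "a \<noteq> b"
  shows "\<exists>z. card (expansions q z) = 1 \<and> card (expansions q (z + 1)) = 1"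
  using assms(2-)
proof (induction "card (expansions q x)" arbitrary: x a b rule: less_induct)
  case less
  from less.prems(4) obtain n where "a n \<noteq> b n" by auto
  from exists_branching_point[OF q less.prems(1-3) this]
  obtain y where y: "finite (expansions q y)" "card (expansions q y) \<le> card (expansions q x)"
    and ne: "expansions q (q * y) \<noteq> {}" "expansions q (q * y - 1) \<noteq> {}" by blast
  note fin = finite_expansions_branch[OF q y(1)]
  have pos: "card (expansions q (q * y)) > 0" "card (expansions q (q * y - 1)) > 0"
    using fin ne by (simp_all add: card_gt_0_iff)
  then have lt: "card (expansions q (q * y)) < card (expansions q x)"
    "card (expansions q (q * y - 1)) < card (expansions q x)"
    using card_expansions_branch[OF q y(1)] y(2) by linarith+
  have one: "card (expansions q w) = 1 \<or> ?case"
    if w: "finite (expansions q w)" "expansions q w \<noteq> {}"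
      "card (expansions q w) < card (expansions q x)" for w
  proof (cases "\<exists>c d. c \<in> expansions q w \<and> d \<in> expansions q w \<and> c \<noteq> d")
    case True
    then show ?thesis using less.hyps[OF w(3,1)] by blast
  next
    case False
    with w(2) obtain c where "expansions q w = {c}" by auto
    then show ?thesis by simp
  qed
  \<comment> \<open>The witness is \<open>z = q * y - 1\<close>, so that
    \<open>z + 1 = q * y\<close>.\<close>
  from one[OF fin(1) ne(1) lt(1)] one[OF fin(2) ne(2) lt(2)]
  show ?case by (metis diff_add_cancel)
qed

section \<open>Existence and reflection\<close>

lemma sums_full_digits:
  fixes q :: real
  assumes "q > 1"
  shows "(\<lambda>n. 1 / q ^ Suc n) sums (1 / (q - 1))"
proof -
  have "(\<lambda>n. (1 / q) * (1 / q) ^ n) sums ((1 / q) * (1 / (1 - 1 / q)))"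
    using assms by (intro sums_mult geometric_sums) auto
  moreover have "(1 / q) * (1 / (1 - 1 / q)) = 1 / (q - 1)"
    using assms by (simp add: field_simps)
  ultimately show ?thesis by (simp add: power_one_over)
qed

lemma expansion_bounds:
  assumes "q > 1" "expansion q x a"
  shows "0 \<le> x" "x \<le> 1 / (q - 1)"
proof -
  have a: "a n \<in> {0, 1}" and s: "(\<lambda>n. real (a n) / q ^ Suc n) sums x" for n
    using assms by (auto simp: expansion_def)
  have le: "real (a n) \<le> 1" for n using a[of n] by auto
  show "0 \<le> x" using assms by (intro sums_le[OF _ sums_zero s]) auto
  show "x \<le> 1 / (q - 1)"
    using assms le by (intro sums_le[OF _ s sums_full_digits]) (auto intro!: divide_right_mono)
qed

text \<open>Greedy algorithm: take digit 1 whenever possible. The orbit \<open>y\<close> of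
  remainders stays in the admissible interval because \<open>q < 2\<close> gives
  \<open>1 \<le> 1 / (q - 1)\<close>.\<close>

lemma expansion_exists:
  assumes q: "1 < q" "q < 2" and x: "0 \<le> x" "x \<le> 1 / (q - 1)"
  shows "\<exists>a. expansion q x a"
proof -
  define d :: "real \<Rightarrow> nat" where "d y = (if y \<ge> 1 / q then 1 else 0)" for y
  define y where "y = rec_nat x (\<lambda>_ z. q * z - real (d z))"
  have y0: "y 0 = x" and yS: "y (Suc n) = q * y n - real (d (y n))" for n
    by (simp_all add: y_def)
  have bd: "0 \<le> y n \<and> y n \<le> 1 / (q - 1)" for n
  proof (induction n)
    case 0 then show ?case using x by (simp add: y0)
  next
    case (Suc n)
    have "q * y n \<le> q * (1 / (q - 1))" using Suc q by (intro mult_left_mono) auto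
    moreover have "q * (1 / (q - 1)) = 1 / (q - 1) + 1" using q by (simp add: field_simps)
    moreover have "1 \<le> 1 / (q - 1)" using q by (simp add: field_simps)
    moreover have "y n \<ge> 1 / q \<longleftrightarrow> q * y n \<ge> 1" using q by (simp add: field_simps)
    moreover have "0 \<le> q * y n" using Suc q by simp
    ultimately show ?case unfolding yS d_def by (cases "1 / q \<le> y n"; simp; linarith)
  qed
  have part: "(\<Sum>k<n. real (d (y k)) / q ^ Suc k) = x - y n / q ^ n" for n
  proof (induction n)
    case (Suc n)
    have "y (Suc n) / q ^ Suc n = y n / q ^ n - real (d (y n)) / q ^ Suc n"
      using q by (simp add: yS diff_divide_distrib)
    then show ?case using Suc by simp
  qed (simp add: y0)
  have "(\<lambda>n. y n / q ^ n) \<longlonglongrightarrow> 0"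
  proof (rule tendsto_sandwich[where f = "\<lambda>_. 0" and h = "\<lambda>n. 1 / (q - 1) / q ^ n"])
    have "(\<lambda>n. 1 / (q - 1) * (1 / q) ^ n) \<longlonglongrightarrow> 1 / (q - 1) * 0"
      using q by (intro tendsto_mult tendsto_const LIMSEQ_realpow_zero) auto
    then show "(\<lambda>n. 1 / (q - 1) / q ^ n) \<longlonglongrightarrow> 0" by (simp add: power_one_over)
    show "\<forall>\<^sub>F n in sequentially. 0 \<le> y n / q ^ n" using bd q by auto
    show "\<forall>\<^sub>F n in sequentially. y n / q ^ n \<le> 1 / (q - 1) / q ^ n"
      using bd q by (intro always_eventually allI divide_right_mono) auto
  qed auto
  from tendsto_diff[OF tendsto_const[of x] this]
  have "(\<lambda>n. real (d (y n)) / q ^ Suc n) sums x"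
    unfolding sums_def part by simp
  then have "expansion q x (\<lambda>n. d (y n))" by (auto simp: expansion_def d_def)
  then show ?thesis by blast
qed

lemma expansions_nonempty_iff:
  assumes "1 < q" "q < 2"
  shows "expansions q x \<noteq> {} \<longleftrightarrow> 0 \<le> x \<and> x \<le> 1 / (q - 1)"
  using expansion_exists[of q x] expansion_bounds[of q x] assms by (auto simp: expansions_def)

lemma expansion_reflect:
  assumes "q > 1" "expansion q x a"
  shows "expansion q (1 / (q - 1) - x) (\<lambda>n. 1 - a n)"
proof -
  have a: "a n \<in> {0, 1}" for n using assms by (auto simp: expansion_def)
  have "(\<lambda>n. 1 / q ^ Suc n - real (a n) / q ^ Suc n) sums (1 / (q - 1) - x)"
    using assms by (intro sums_diff sums_full_digits) (auto simp: expansion_def)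
  moreover have "1 / q ^ Suc n - real (a n) / q ^ Suc n = real (1 - a n) / q ^ Suc n" for n
    using a[of n] by auto
  ultimately show ?thesis by (auto simp: expansion_def)
qed

lemma card_expansions_reflect:
  assumes "q > 1"
  shows "card (expansions q (1 / (q - 1) - x)) = card (expansions q x)"
proof -
  let ?r = "\<lambda>(a :: nat \<Rightarrow> nat) n. 1 - a n" and ?I = "1 / (q - 1)"
  \<comment> \<open>Subtraction on naturals is truncated, so swapping digits is an involution only
    on 0-1 sequences.\<close>
  have inv: "?r (?r a) = a" if "a \<in> expansions q y" for a y
  proof
    fix n
    have "a n \<in> {0, 1}" using that by (auto simp: expansions_def expansion_def)
    then show "?r (?r a) n = a n" by auto
  qed
  have sub: "?r ` expansions q y \<subseteq> expansions q (?I - y)" for y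
    using expansion_reflect[OF assms, of y] by (auto simp: expansions_def)
  have "bij_betw ?r (expansions q (?I - x)) (expansions q x)"
  proof (rule bij_betw_byWitness[where f' = ?r])
    show "?r ` expansions q (?I - x) \<subseteq> expansions q x"
      using sub[of "?I - x"] unfolding diff_diff_eq2 add_diff_cancel_left' .
  qed (use inv sub in blast)+
  then show ?thesis by (rule bij_betw_same_card)
qed

section \<open>Points with a unique expansion\<close>

text \<open>Exactly one branch is inhabited, so the other point lies outside
  \<open>[0, 1/(q-1)]\<close>. Since \<open>q * z \<ge> 0\<close> and
  \<open>q * z - 1 \<le> 1 / (q - 1)\<close>, it can only have left on one side.\<close>

lemma unique_step:
  assumes q: "1 < q" "q < 2" and u: "card (expansions q z) = 1"
  shows "0 \<le> z \<and> z \<le> 1 / (q - 1) \<and>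
    (q * z < 1 \<and> card (expansions q (q * z)) = 1 \<or>
     q * z > 1 / (q - 1) \<and> card (expansions q (q * z - 1)) = 1)"
proof -
  have q0: "q > 0" and fin: "finite (expansions q z)" and "expansions q z \<noteq> {}"
    using q u by (auto intro: card_ge_0_finite)
  then have z: "0 \<le> z" "z \<le> 1 / (q - 1)" using expansions_nonempty_iff[OF q] by auto
  have fins: "finite (expansions q (q * z))" "finite (expansions q (q * z - 1))"
    using finite_expansions_branch[OF q0 fin] by auto
  have "q * z \<le> q * (1 / (q - 1))" using z q by (intro mult_left_mono) auto
  moreover have "q * (1 / (q - 1)) = 1 / (q - 1) + 1" using q by (simp add: field_simps)
  ultimately have le: "q * z - 1 \<le> 1 / (q - 1)" by linarith
  have ge: "q * z \<ge> 0" using z q by simp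
  consider "card (expansions q (q * z)) = 1" "card (expansions q (q * z - 1)) = 0"
    | "card (expansions q (q * z)) = 0" "card (expansions q (q * z - 1)) = 1"
    using card_expansions_branch[OF q0 fin] u by linarith
  then show ?thesis
  proof cases
    case 1
    then have "expansions q (q * z - 1) = {}" using fins by simp
    then have "q * z < 1" using expansions_nonempty_iff[OF q, of "q * z - 1"] le by auto
    with 1 z show ?thesis by blast
  next
    case 2
    then have "expansions q (q * z) = {}" using fins by simp
    then have "q * z > 1 / (q - 1)" using expansions_nonempty_iff[OF q, of "q * z"] ge by auto
    with 2 z show ?thesis by blast
  qed
qed

text \<open>The hypothesis \<open>q (q - 1)\<^sup>2 < 1\<close> is \<open>q < q_f\<close>; it says that \<open>q - 1 < 1/(q(q-1))\<close>, so after
  one step from \<open>(1/(q(q-1)), 1)\<close> the orbit has to be to the left of the switch region.\<close>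

lemma unique_two_steps:
  assumes q: "1 < q" "q < 2" and qf: "q * (q - 1)\<^sup>2 < 1"
    and u: "card (expansions q y) = 1" and y: "q * y > 1 / (q - 1)" "y < 1"
  shows "card (expansions q (q\<^sup>2 * y - q)) = 1 \<and> q * (q\<^sup>2 * y - q) > 1 / (q - 1) \<and> q\<^sup>2 * y - q < 1"
proof -
  have I: "1 / (q - 1) > 1" using q by (simp add: field_simps)
  have qm: "(q - 1) * q < 1 / (q - 1)"
    using q qf by (simp add: field_simps power2_eq_square)
  define w where "w = q * y - 1"
  have uw: "card (expansions q w) = 1"
    using unique_step[OF q u] y I by (auto simp: w_def)
  have "w < q - 1" using y q by (simp add: w_def)
  then have "q * w < q * (q - 1)" using q by (intro mult_strict_left_mono) auto
  then have "\<not> q * w > 1 / (q - 1)" using qm by (simp add: mult.commute)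
  with unique_step[OF q uw] have w: "q * w < 1" "card (expansions q (q * w)) = 1" by auto
  \<comment> \<open>Digit 0 is excluded for the third step: the lower bound on \<open>y\<close>
    gives one on \<open>w\<close>, and \<open>q^2 (2 - q) > q - 1\<close> is again
    \<open>q (q - 1)^2 < 1\<close>.\<close>
  have "q * (q * w) \<ge> q * (q * (1 / (q - 1) - 1))"
    using y q by (intro mult_left_mono) (auto simp: w_def)
  moreover have "q * (q * (1 / (q - 1) - 1)) > 1"
  proof -
    have "q * (q * (2 - q)) - (q - 1) = 1 - q * (q - 1)\<^sup>2"
      by (simp add: power2_eq_square algebra_simps)
    then have "q * (q * (2 - q)) > q - 1" using qf by linarith
    then have "q * (q * (2 - q)) / (q - 1) > 1" using q by (simp add: field_simps)
    moreover have "1 / (q - 1) - 1 = (2 - q) / (q - 1)" using q by (simp add: field_simps)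
    ultimately show ?thesis by simp
  qed
  ultimately have "\<not> q * (q * w) < 1" by linarith
  with unique_step[OF q w(2)] have "q * (q * w) > 1 / (q - 1)" by auto
  moreover have "q * w = q\<^sup>2 * y - q" by (simp add: w_def power2_eq_square algebra_simps)
  ultimately show ?thesis using w by simp
qed

text \<open>The two-step map multiplies the distance to its fixed point by \<open>q^2\<close>, yet
  all iterates remain in \<open>[0, 1)\<close>; hence that distance is zero.\<close>

lemma unique_cycle:
  assumes q: "1 < q" "q < 2" and qf: "q * (q - 1)\<^sup>2 < 1"
    and u: "card (expansions q y) = 1" and y: "q * y > 1 / (q - 1)" "y < 1"
  shows "y = q / (q\<^sup>2 - 1)"
proof (rule ccontr)
  define c where "c = q / (q\<^sup>2 - 1)"
  assume "y \<noteq> q / (q\<^sup>2 - 1)"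
  then have ne: "\<bar>y - c\<bar> > 0" by (simp add: c_def)
  have q2: "q\<^sup>2 > 1" using q by simp
  have c: "q\<^sup>2 * c - q = c" using q2 by (simp add: c_def field_simps)
  \<comment> \<open>Closed form of the \<open>k\<close>-th iterate of the two-step map started at
    \<open>y\<close>.\<close>
  define v where "v k = c + (q\<^sup>2) ^ k * (y - c)" for k
  have vS: "v (Suc k) = q\<^sup>2 * v k - q" for k
    using c by (simp add: v_def algebra_simps)
  have v: "card (expansions q (v k)) = 1 \<and> q * v k > 1 / (q - 1) \<and> v k < 1" for k
  proof (induction k)
    case 0 then show ?case using u y by (simp add: v_def)
  next
    case (Suc k) then show ?case using unique_two_steps[OF q qf, of "v k"] by (simp add: vS)
  qed
  obtain k where k: "(1 + \<bar>c\<bar>) / \<bar>y - c\<bar> < (q\<^sup>2) ^ k" using real_arch_pow[OF q2] by blast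
  then have "1 + \<bar>c\<bar> < (q\<^sup>2) ^ k * \<bar>y - c\<bar>" using ne by (simp add: field_simps)
  also have "\<dots> = \<bar>v k - c\<bar>" using q2 by (simp add: v_def abs_mult)
  also have "\<dots> \<le> \<bar>v k\<bar> + \<bar>c\<bar>" by (rule abs_triangle_ineq4)
  finally have "1 < \<bar>v k\<bar>" by linarith
  moreover have "0 \<le> v k" using unique_step[OF q] v by blast
  ultimately show False using v[of k] by auto
qed

text \<open>\<open>n\<close> bounds the number of leading zeros: digit 0 replaces \<open>y\<close>
  by \<open>q * y\<close>, still below 1, and the first digit 1 puts the point under
  \<open>unique_cycle\<close>.\<close>

lemma unique_below_one:
  assumes q: "1 < q" "q < 2" and qf: "q * (q - 1)\<^sup>2 < 1"
    and u: "card (expansions q y) = 1" and y: "y < 1" "q * (q ^ n * y) \<ge> 1"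
  shows "\<exists>m. y = q / (q\<^sup>2 - 1) / q ^ m"
  using u y
proof (induction n arbitrary: y)
  case 0
  then have "y = q / (q\<^sup>2 - 1)"
    using unique_step[OF q 0(1)] unique_cycle[OF q qf 0(1)] by auto
  then show ?case by (intro exI[of _ 0]) simp
next
  case (Suc n)
  consider "q * y < 1" "card (expansions q (q * y)) = 1" | "q * y > 1 / (q - 1)"
    using unique_step[OF q Suc.prems(1)] by blast
  then show ?case
  proof cases
    case 1
    then obtain m where "q * y = q / (q\<^sup>2 - 1) / q ^ m"
      using Suc.IH[of "q * y"] Suc.prems by (auto simp: mult_ac)
    moreover have "y = q * y / q" using q by simp
    ultimately have "y = q / (q\<^sup>2 - 1) / q ^ Suc m" by (simp add: mult.commute)
    then show ?thesis ..
  next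
    case 2
    then have "y = q / (q\<^sup>2 - 1)" using unique_cycle[OF q qf] Suc.prems by blast
    then show ?thesis by (intro exI[of _ 0]) simp
  qed
qed

text \<open>A point with first digit 0 lies below 1, and unless it is 0 some power of
  \<open>q\<close> carries it past 1. First digit 1 reduces to this by reflection.\<close>

lemma unique_values:
  assumes q: "1 < q" "q < 2" and qf: "q * (q - 1)\<^sup>2 < 1" and u: "card (expansions q z) = 1"
  shows "z = 0 \<or> z = 1 / (q - 1) \<or>
    (\<exists>n. z = q / (q\<^sup>2 - 1) / q ^ n \<or> z = 1 / (q - 1) - q / (q\<^sup>2 - 1) / q ^ n)"
proof -
  have main: "w = 0 \<or> (\<exists>n. w = q / (q\<^sup>2 - 1) / q ^ n)"
    if w: "card (expansions q w) = 1" "w < 1" for w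
  proof (cases "w = 0")
    case False
    then have pos: "w > 0" using unique_step[OF q w(1)] by auto
    obtain n where "1 / w < q ^ n" using real_arch_pow[OF q(1)] by blast
    then have "1 < q ^ n * w" using pos by (simp add: field_simps)
    moreover have "q ^ n * w \<le> q * (q ^ n * w)" using pos q by simp
    ultimately show ?thesis using unique_below_one[OF q qf w, of n] by simp
  qed simp
  consider "q * z < 1" | "q * z > 1 / (q - 1)" using unique_step[OF q u] by blast
  then show ?thesis
  proof cases
    case 1
    have "z \<le> q * z" using unique_step[OF q u] q by (simp add: mult_le_cancel_right1)
    with 1 show ?thesis using main[OF u] by auto
  next
    case 2
    let ?w = "1 / (q - 1) - z"
    have "q * ?w < 1" using 2 q by (simp add: field_simps)
    moreover have "?w \<le> q * ?w" using unique_step[OF q u] q by (simp add: mult_le_cancel_right1)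
    ultimately have "?w = 0 \<or> (\<exists>n. ?w = q / (q\<^sup>2 - 1) / q ^ n)"
      using main[of ?w] u card_expansions_reflect[OF q(1), of z] by simp
    then show ?thesis by (auto simp: algebra_simps)
  qed
qed

section \<open>Differences of two such points\<close>

text \<open>After multiplication by \<open>q\<^sup>2 - 1\<close> a difference equal to \<open>1\<close> amounts to
  \<open>q\<^sup>1\<^sup>-\<^sup>n + q\<^sup>1\<^sup>-\<^sup>m = 2 + q - q\<^sup>2\<close> (or to a degenerate form of it); \<open>q_two\<close> is the solution for
  \<open>{n, m} = {2, 4}\<close> and \<open>q_f\<close> the one for \<open>{n, m} = {2, 5}\<close>.\<close>

lemma power_sum_neq:
  fixes q :: real
  assumes q: "1.61 < q" "q < 1.755" and g: "q\<^sup>2 > q + 1" and qf: "q * (q - 1)\<^sup>2 < 1"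
    and q2: "q ^ 4 \<noteq> 2 * q\<^sup>2 + q + 1" and nm: "n \<le> m"
  shows "q / q ^ n + q / q ^ m \<noteq> 2 + q - q\<^sup>2"
proof -
  define s where "s k = q / q ^ k" for k :: nat
  define f where "f = 2 + q - q\<^sup>2"
  have anti: "s k \<le> s j" if "j \<le> k" for j k
    using q that by (auto simp: s_def intro!: divide_left_mono power_increasing)
  have pos: "s k > 0" for k using q by (simp add: s_def)
  have sv: "s 1 = 1" "s 2 = 1 / q" "s 3 = 1 / q\<^sup>2" "s 4 = 1 / q ^ 3" "s 5 = 1 / q ^ 4"
    using q by (simp_all add: s_def field_simps power_numeral_reduce)
  \<comment> \<open>Since \<open>s\<close> decreases, the bounds \<open>f1\<close>,
    \<open>f23\<close>, \<open>f25\<close>, \<open>f33\<close> exclude all pairs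
    \<open>n \<le> m\<close> but \<open>(2, 4)\<close>, left to \<open>f24\<close>. After clearing
    denominators, \<open>f23\<close>, \<open>f24\<close>, \<open>f25\<close> have factors controlled
    by \<open>g\<close>, \<open>q2\<close>, \<open>qf\<close> respectively.\<close>
  have f1: "f < 1" using g by (simp add: f_def)
  have f23: "f < s 2 + s 3"
  proof -
    have "(q\<^sup>2 - q - 1) * (q\<^sup>2 - 1) > 0" using g q by (intro mult_pos_pos) auto
    moreover have "(s 2 + s 3 - f) * q\<^sup>2 = (q\<^sup>2 - q - 1) * (q\<^sup>2 - 1)"
      using q by (simp add: sv f_def field_simps power_numeral_reduce)
    ultimately have "(s 2 + s 3 - f) * q\<^sup>2 > 0" by linarith
    then show ?thesis using q by (simp add: zero_less_mult_iff)
  qed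
  have f24: "f \<noteq> s 2 + s 4"
  proof
    assume "f = s 2 + s 4"
    moreover have "(s 2 + s 4 - f) * q ^ 3 = (q ^ 4 - 2 * q\<^sup>2 - q - 1) * (q - 1)"
      using q by (simp add: sv f_def field_simps power_numeral_reduce)
    ultimately show False using q q2 by auto
  qed
  have f25: "f > s 2 + s 5"
  proof -
    have "(1 - q * (q - 1)\<^sup>2) * ((q\<^sup>2 - 1) * (q + 1)) > 0"
      using qf g q by (intro mult_pos_pos) auto
    moreover have "(f - (s 2 + s 5)) * q ^ 4 = (1 - q * (q - 1)\<^sup>2) * ((q\<^sup>2 - 1) * (q + 1))"
      using q by (simp add: sv f_def field_simps power_numeral_reduce)
    ultimately have "(f - (s 2 + s 5)) * q ^ 4 > 0" by linarith
    then show ?thesis using q by (simp add: zero_less_mult_iff)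
  qed
  have f33: "f > s 3 + s 3"
  proof -
    \<comment> \<open>Division of the quartic by \<open>(q - 1.61) * (q - 1.755)\<close>: the linear
      remainder is its chord over this interval. The quartic lies below the chord, which is negative
      there.\<close>
    have "(q - 1.61) * (1.755 - q) * (q\<^sup>2 + 2.365 * q + 3.132675) > 0"
      using q by (intro mult_pos_pos) (auto intro!: add_pos_pos)
    moreover have "q ^ 4 - q ^ 3 - 2 * q\<^sup>2 + 2 =
      3.859025625 * q - 6.85152984625 - (q - 1.61) * (1.755 - q) * (q\<^sup>2 + 2.365 * q + 3.132675)"
      by algebra
    moreover have "3.859025625 * q - 6.85152984625 < 0" using q by simp
    ultimately have "q ^ 4 - q ^ 3 - 2 * q\<^sup>2 + 2 < 0" by linarith
    moreover have "(f - (s 3 + s 3)) * q\<^sup>2 = - (q ^ 4 - q ^ 3 - 2 * q\<^sup>2 + 2)"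
      using q by (simp add: sv f_def field_simps power_numeral_reduce)
    ultimately have "(f - (s 3 + s 3)) * q\<^sup>2 > 0" by linarith
    then show ?thesis using q by (simp add: zero_less_mult_iff)
  qed
  consider "n \<le> 1" | "n = 2" "m \<le> 3" | "n = 2" "m = 4" | "n = 2" "m \<ge> 5" | "n \<ge> 3"
    by linarith
  then have "s n + s m \<noteq> f"
  proof cases
    case 1 then show ?thesis using anti[of n 1] pos[of m] f1 sv by auto
  next
    case 2 then show ?thesis using anti[of m 3] f23 by auto
  next
    case 3 then show ?thesis using f24 by auto
  next
    case 4 then show ?thesis using anti[of 5 m] f25 by auto
  next
    case 5 then show ?thesis using anti[of 3 n] anti[of 3 m] nm f33 by auto
  qed
  then show ?thesis by (simp add: s_def f_def)
qed

text \<open>Handles the case where one of the two points is an endpoint of the interval: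
  \<open>2 + q - q^2\<close> lies strictly between \<open>1/q\<close> and \<open>1\<close>, two
  consecutive values of the left side.\<close>

lemma power_neq:
  fixes q :: real
  assumes q: "1 < q" "q < 2" and g: "q\<^sup>2 > q + 1" and qf: "q * (q - 1)\<^sup>2 < 1"
  shows "q / q ^ n \<noteq> 2 + q - q\<^sup>2"
proof (cases "n \<le> 1")
  case True
  then have "q / q ^ n \<ge> 1" using q by (cases n) auto
  then show ?thesis using g by linarith
next
  case False
  then have "q / q ^ n \<le> q / q\<^sup>2"
    using q by (intro divide_left_mono power_increasing) auto
  also have "\<dots> = 1 / q" using q by (simp add: power2_eq_square)
  also have "\<dots> < 2 + q - q\<^sup>2"
  proof -
    have "(2 + q - q\<^sup>2) * q - 1 = (1 - q * (q - 1)\<^sup>2) + (q - 1) * (2 - q)"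
      by (simp add: algebra_simps power_numeral_reduce)
    also have "\<dots> > 0" using q qf by (intro add_pos_pos mult_pos_pos) auto
    finally show ?thesis using q by (simp add: field_simps)
  qed
  finally show ?thesis by simp
qed

lemma not_adjacent_unique:
  assumes q: "1.61 < q" "q < 1.755" and g: "q\<^sup>2 > q + 1" and qf: "q * (q - 1)\<^sup>2 < 1"
    and q2: "q ^ 4 \<noteq> 2 * q\<^sup>2 + q + 1"
  shows "\<not> (card (expansions q z) = 1 \<and> card (expansions q (z + 1)) = 1)"
proof
  have q12: "1 < q" "q < 2" using q by auto
  \<comment> \<open>Scaling by \<open>D\<close> turns the points with a unique expansion into
    \<open>0\<close>, \<open>q + 1\<close>, \<open>t n\<close> and \<open>q + 1 - t n\<close>, and
    the gap 1 into \<open>D\<close>.\<close>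
  define D where "D = q\<^sup>2 - 1"
  define t where "t n = q / q ^ n" for n :: nat
  have D: "D > q" using g by (simp add: D_def)
  have t: "0 < t n" "t n \<le> q" for n
    using q12 by (auto simp: t_def field_simps one_le_power)
  have DI: "D * (1 / (q - 1)) = q + 1"
    using q12 by (simp add: D_def power2_eq_square field_simps)
  have form: "D * w = 0 \<or> D * w = q + 1 \<or> (\<exists>n. D * w = t n \<or> D * w = q + 1 - t n)"
    if "card (expansions q w) = 1" for w
  proof -
    have Dt: "D * (q / (q\<^sup>2 - 1) / q ^ n) = t n" for n
      using D q12 unfolding D_def[symmetric] by (simp add: t_def)
    then have "D * (1 / (q - 1) - q / (q\<^sup>2 - 1) / q ^ n) = q + 1 - t n" for n
      using DI by (simp add: right_diff_distrib)
    then show ?thesis using unique_values[OF q12 qf that] DI Dt by (metis mult_zero_right)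
  qed
  have two: "t n + t m \<noteq> q + 1 - D" for n m
    using power_sum_neq[OF q g qf q2, of n m] power_sum_neq[OF q g qf q2, of m n]
    by (cases "n \<le> m") (auto simp: t_def D_def add.commute)
  have one: "t n \<noteq> q + 1 - D" for n
    using power_neq[OF q12 g qf, of n] by (simp add: t_def D_def)
  have zero: "q + 1 \<noteq> D"
  proof -
    have "(2 - q) * (q + 1) > 0" using q12 by (intro mult_pos_pos) auto
    then show ?thesis by (simp add: D_def power2_eq_square algebra_simps)
  qed
  assume u: "card (expansions q z) = 1 \<and> card (expansions q (z + 1)) = 1"
  define a where "a = D * z"
  have F: "a = 0 \<or> a = q + 1 \<or> (\<exists>n. a = t n \<or> a = q + 1 - t n)"
    using form[of z] u by (simp add: a_def)
  have G: "a + D = 0 \<or> a + D = q + 1 \<or> (\<exists>n. a + D = t n \<or> a + D = q + 1 - t n)"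
    using form[of "z + 1"] u by (simp add: a_def algebra_simps)
  have a0: "a \<ge> 0" using F t q12 by (smt (verit))
  \<comment> \<open>As \<open>a + D \<ge> D > q \<ge> t n\<close>, the upper point is the right
    endpoint or a reflected one.\<close>
  with G D t q12 consider "a + D = q + 1" | m where "a + D = q + 1 - t m"
    by (smt (verit))
  then show False
  proof cases
    case 1
    with F D t q12 one zero show False by (smt (verit))
  next
    case (2 m)
    \<comment> \<open>Two reflected points would give \<open>D = t n - t m < q\<close>.\<close>
    have "a \<noteq> q + 1 - t n" for n using 2 D t[of n] t[of m] by linarith
    moreover have "a \<noteq> t n" for n using 2 two[of n m] by linarith
    moreover have "a \<noteq> q + 1" using 2 D t[of m] q12 by linarith
    moreover have "a \<noteq> 0" using 2 one[of m] by linarith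
    ultimately show False using F by blast
  qed
qed

section \<open>The constants golden and q_f as inequalities\<close>

lemma golden_less_imp:
  assumes "golden < q"
  shows "q + 1 < q\<^sup>2"
proof -
  have "(golden - 1) * golden = 1"
    by (simp add: golden_def field_simps)
  moreover have "(golden - 1) * golden < (q - 1) * q"
    using assms golden_bounds by (intro mult_strict_mono) auto
  ultimately show ?thesis by (simp add: power2_eq_square algebra_simps)
qed

text \<open>The cubic defining \<open>q_f\<close> is \<open>x (x - 1)^2 = 1\<close>, whose left side
  increases for \<open>x > 1\<close>.\<close>

lemma less_q_f_imp:
  assumes "1 < q" "q < q_f"
  shows "q * (q - 1)\<^sup>2 < 1"
proof -
  have "q_f ^ 3 = 2 * q_f\<^sup>2 - q_f + 1"
    unfolding q_f_def by (rule theI'[OF ex1_q_f])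
  then have "q_f * (q_f - 1)\<^sup>2 = 1"
    by (simp add: algebra_simps power_numeral_reduce)
  moreover have "q * (q - 1)\<^sup>2 < q_f * (q_f - 1)\<^sup>2"
    using assms by (intro mult_strict_mono power_strict_mono) auto
  ultimately show ?thesis by simp
qed

theorem theorem2p8:
  fixes q x :: real
  assumes "q \<in> {golden<..<q_two} \<union> {q_two<..<q_f}"
    and "x \<in> {0..1 / (q - 1)}"
  shows "(\<exists>!a. expansion q x a) \<or> infinite {a. expansion q x a}"
proof (rule ccontr)
  assume neg: "\<not> ?thesis"
  have q: "golden < q" "q < q_f" "q \<noteq> q_two"
    using assms(1) q_two_approx q_f_approx golden_bounds by auto
  then have b: "1.61 < q" "q < 1.755" using golden_bounds q_f_approx by auto
  have q2: "q ^ 4 \<noteq> 2 * q\<^sup>2 + q + 1"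
  proof
    assume "q ^ 4 = 2 * q\<^sup>2 + q + 1"
    then have "golden < q \<and> q < 2 \<and> q ^ 4 = 2 * q\<^sup>2 + q + 1" using q b by auto
    then have "q_two = q" unfolding q_two_def by (rule the1_equality[OF ex1_q_two])
    then show False using q by simp
  qed
  have "\<exists>a. expansion q x a" using expansion_exists[of q x] assms(2) b by auto
  then obtain a b where "expansion q x a" "expansion q x b" "a \<noteq> b" using neg by auto
  moreover have "finite (expansions q x)" using neg by (simp add: expansions_def)
  ultimately obtain z where "card (expansions q z) = 1 \<and> card (expansions q (z + 1)) = 1"
    using exists_adjacent_unique[of q x a b] \<open>1.61 < q\<close> by (auto simp: expansions_def)
  then show False
    using not_adjacent_unique[OF b golden_less_imp[OF q(1)] less_q_f_imp q2] q b by auto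
qed

end
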